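(* There exists an absolute constant $\kappa_2>0$ such that the following holds. Let $\mathcal{G}$ be a class of classifiers $g:\mathbb{R}^d\to\{0,1\}$ with finite VC dimension $V$, let $n\ge 1$ be an integer, $h\in(0,1]$ and $e_m\in(0,1]$. Suppose $V\ge 2$ and $n e_m\ge V$, and suppose the propensity is constant: $e(x)=e_m$ for all $x\in\mathbb{R}^d$. Let $h'=\sqrt{\frac{V}{n e_m}}$. Then the minimax risk $\mathcal{R}(\mathcal{G},h)$ satisfies: 1. if $h\ge h'$, then $\displaystyle \mathcal{R}(\mathcal{G},h)\ge\kappa_2\,\frac{V-1}{h\,n\,e_m}$; 2. if $h\le h'$, then $\displaystyle \mathcal{R}(\mathcal{G},h)\ge\kappa_2\sqrt{\frac{V-1}{n\,e_m}}$.
   Context: Positive-unlabeled model: given a distribution $\mathbb{P}$ of $(X,Y)$ on $\mathbb{R}^d\times\{0,1\}$ and a propensity function $e:\mathbb{R}^d\to(0,1]$, the observed label $S\in\{0,1\}$ satisfies $\mathbb{P}(S=1\mid Y=1,X=x)=e(x)$ and $\mathbb{P}(S=1\mid Y=0,X=x)=0$. The training sample consists of i.i.d. copies $(X_1,S_1),\dots,(X_n,S_n)$ of $(X,S)$; the classes $Y_i$ are not observed. Let $\eta(x)=\mathbb{P}(Y=1\mid X=x)$, $g^*(x)=\mathbf{1}_{\eta(x)\ge1/2}$ (Bayes classifier), $R(g)=\mathbb{P}(g(X)\ne Y)$ and $\ell(g,g^* )=R(g)-R(g^* )$. $\mathcal{P}(\mathcal{G},h)$ is the set of probability distributions $\mathbb{P}$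 of $(X,Y)$ on $\mathbb{R}^d\times\{0,1\}$ such that $g^*\in\mathcal{G}$ and $|2\eta(x)-1|\ge h$ for every $x\in\mathbb{R}^d$. Since $\eta$ is determined by $\mathbb{P}$ only up to null sets of the law of $X$, this means that these two properties hold for some version of $\eta$. The minimax risk is $$\mathcal{R}(\mathcal{G},h)=\inf_{\widehat g\in\mathcal{G}}\ \sup_{\mathbb{P}\in\mathcal{P}(\mathcal{G},h)}\mathbb{E}\left[\ell(\widehat g,g^* )\right],$$ where the infimum is over all (measurable) functions $\widehat g$ of the sample $(X_i,S_i)_{1\le i\le n}$ with values in $\mathcal{G}$, and the expectation is over the sample (drawn under $\mathbb{P}$ and the propensity $e$). The VC dimension of $\mathcal{G}$ is the largest integer $V$ such that some points $x_1,\dots,x_V\in\mathbb{R}^d$ are shattered by $\mathcal{G}$, i.e. $|\{(g(x_1),\dots,g(x_V)):g\in\mathcal{G}\}|=2^V$. "Absolute constant" means it depends on none of the other objects. *)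

theory Defs
  imports "HOL-Probability.Probability"
begin

text \<open>
  The dimension is a natural number rather than a type, so that a constant can be chosen
  before it. The space \<open>\<real>\<^sup>d\<close> consists of the functions in \<open>{..<d} \<rightarrow>\<^sub>E UNIV\<close>, with
  the product (equivalently, Borel) sigma-algebra. Labels 0 and 1 are \<open>False\<close> and \<open>True\<close>.
\<close>

definition Rd :: "nat \<Rightarrow> (nat \<Rightarrow> real) measure" where
  "Rd d = (\<Pi>\<^sub>M i\<in>{..<d}. borel)"

type_synonym classifier = "(nat \<Rightarrow> real) \<Rightarrow> bool"

definition labelled_space :: "nat \<Rightarrow> ((nat \<Rightarrow> real) \<times> bool) measure" where
  "labelled_space d = Rd d \<Otimes>\<^sub>M count_space UNIV"

definition distributions :: "nat \<Rightarrow> ((nat \<Rightarrow> real) \<times> bool) measure set" where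
  "distributions d = {P. prob_space P \<and> sets P = sets (labelled_space d)}"

definition is_regression_function ::
    "nat \<Rightarrow> ((nat \<Rightarrow> real) \<times> bool) measure \<Rightarrow> ((nat \<Rightarrow> real) \<Rightarrow> real) \<Rightarrow> bool" where
  "is_regression_function d P \<eta> \<longleftrightarrow>
     \<eta> \<in> borel_measurable (Rd d) \<and>
     (\<forall>x\<in>space (Rd d). 0 \<le> \<eta> x \<and> \<eta> x \<le> 1) \<and>
     (AE z in P. \<eta> (fst z) =
        real_cond_exp P (vimage_algebra (space P) fst (Rd d)) (\<lambda>z. of_bool (snd z)) z)"

definition bayes_classifier :: "((nat \<Rightarrow> real) \<Rightarrow> real) \<Rightarrow> classifier" where
  "bayes_classifier \<eta> = (\<lambda>x. \<eta> x \<ge> 1/2)"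

definition risk :: "((nat \<Rightarrow> real) \<times> bool) measure \<Rightarrow> classifier \<Rightarrow> real" where
  "risk P g = measure P {z \<in> space P. g (fst z) \<noteq> snd z}"

text \<open>
  Two regression functions of \<open>P\<close> agree almost everywhere, so the risk of the Bayes
  classifier does not depend on the version that is chosen here.
\<close>

definition excess_risk ::
    "nat \<Rightarrow> ((nat \<Rightarrow> real) \<times> bool) measure \<Rightarrow> classifier \<Rightarrow> real" where
  "excess_risk d P g =
     risk P g - risk P (bayes_classifier (SOME \<eta>. is_regression_function d P \<eta>))"

text \<open>
  Classifiers are total functions on \<open>nat \<Rightarrow> real\<close>; membership of the Bayes classifier in
  \<open>G\<close> is therefore equality with an element of \<open>G\<close> on all of \<open>\<real>\<^sup>d\<close>.
\<close>

definition margin_class ::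
    "nat \<Rightarrow> classifier set \<Rightarrow> real \<Rightarrow> ((nat \<Rightarrow> real) \<times> bool) measure set" where
  "margin_class d G h =
     {P \<in> distributions d. \<exists>\<eta>. is_regression_function d P \<eta> \<and>
        (\<exists>g\<in>G. \<forall>x\<in>space (Rd d). g x = bayes_classifier \<eta> x) \<and>
        (\<forall>x\<in>space (Rd d). \<bar>2 * \<eta> x - 1\<bar> \<ge> h)}"

text \<open>
  Law of \<open>((X, Y), S)\<close>: given \<open>X = x\<close> and \<open>Y = y\<close>, the observed label \<open>S\<close> is Bernoulli with
  parameter \<open>e x\<close> if \<open>y = 1\<close> and \<open>0\<close> if \<open>y = 0\<close>.
\<close>

definition pu_joint_law ::
    "((nat \<Rightarrow> real) \<Rightarrow> real) \<Rightarrow> ((nat \<Rightarrow> real) \<times> bool) measure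
       \<Rightarrow> (((nat \<Rightarrow> real) \<times> bool) \<times> bool) measure" where
  "pu_joint_law e P =
     density (P \<Otimes>\<^sub>M count_space UNIV)
       (\<lambda>((x, y), s). ennreal (pmf (bernoulli_pmf (if y then e x else 0)) s))"

definition observed_law ::
    "nat \<Rightarrow> ((nat \<Rightarrow> real) \<Rightarrow> real) \<Rightarrow> ((nat \<Rightarrow> real) \<times> bool) measure
       \<Rightarrow> ((nat \<Rightarrow> real) \<times> bool) measure" where
  "observed_law d e P =
     distr (pu_joint_law e P) (labelled_space d) (\<lambda>((x, y), s). (x, s))"

definition sample_space :: "nat \<Rightarrow> nat \<Rightarrow> (nat \<Rightarrow> (nat \<Rightarrow> real) \<times> bool) measure" where
  "sample_space d n = (\<Pi>\<^sub>M i\<in>{..<n}. labelled_space d)"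

definition sample_law ::
    "nat \<Rightarrow> nat \<Rightarrow> ((nat \<Rightarrow> real) \<Rightarrow> real) \<Rightarrow> ((nat \<Rightarrow> real) \<times> bool) measure
       \<Rightarrow> (nat \<Rightarrow> (nat \<Rightarrow> real) \<times> bool) measure" where
  "sample_law d n e P = (\<Pi>\<^sub>M i\<in>{..<n}. observed_law d e P)"

text \<open>
  Measurability of an estimator is joint measurability in the sample and the point to be
  classified, which makes the excess risk a measurable function of the sample.
\<close>

definition estimators ::
    "nat \<Rightarrow> nat \<Rightarrow> classifier set \<Rightarrow> ((nat \<Rightarrow> (nat \<Rightarrow> real) \<times> bool) \<Rightarrow> classifier) set" where
  "estimators d n G =
     {g. (\<forall>s\<in>space (sample_space d n). g s \<in> G) \<and>
         (\<lambda>(s, x). g s x) \<in> sample_space d n \<Otimes>\<^sub>M Rd d \<rightarrow>\<^sub>M count_space UNIV}"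

definition minimax_risk ::
    "nat \<Rightarrow> nat \<Rightarrow> ((nat \<Rightarrow> real) \<Rightarrow> real) \<Rightarrow> classifier set \<Rightarrow> real \<Rightarrow> ereal" where
  "minimax_risk d n e G h =
     (INF g\<in>estimators d n G. SUP P\<in>margin_class d G h.
        ereal (\<integral>s. excess_risk d P (g s) \<partial>sample_law d n e P))"

definition shatters :: "classifier set \<Rightarrow> (nat \<Rightarrow> real) list \<Rightarrow> bool" where
  "shatters G xs \<longleftrightarrow> card ((\<lambda>g. map g xs) ` G) = 2 ^ length xs"

definition has_vc_dimension :: "nat \<Rightarrow> classifier set \<Rightarrow> nat \<Rightarrow> bool" where
  "has_vc_dimension d G V \<longleftrightarrow>
     (\<exists>xs. set xs \<subseteq> space (Rd d) \<and> length xs = V \<and> shatters G xs) \<and>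
     (\<forall>xs. set xs \<subseteq> space (Rd d) \<and> shatters G xs \<longrightarrow> length xs \<le> V)"

end

theory Submission imports Defs begin

text \<open>
  The lower bound is Assouad's argument. Let \<open>x\<^sub>0, \<dots>, x\<^sub>m\<close> with \<open>m = V - 1\<close> be shattered by \<open>G\<close>.
  The marginal of \<open>X\<close> gives a small mass \<open>p\<close> to each of \<open>x\<^sub>0, \<dots>, x\<^bsub>m-1\<^esub>\<close> and the rest to
  \<open>x\<^sub>m\<close>. For every \<open>B \<subseteq> {..<m}\<close> the class contains a classifier \<open>g\<^sub>B\<close> that picks out exactly
  \<open>{x\<^sub>j | j \<in> B}\<close>, and the regression function \<open>(1 \<plusminus> H) / 2\<close>, with sign given by \<open>g\<^sub>B\<close>, defines a
  distribution whose Bayes classifier is \<open>g\<^sub>B\<close>. Its excess risk at \<open>g\<close> is \<open>H\<close> times the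
  mass on which \<open>g\<close> and \<open>g\<^sub>B\<close> differ, that is, at least \<open>H p\<close> times the number of wrong bits among
  the first \<open>m\<close>. Flipping one bit of \<open>B\<close> must be hard to detect from the sample: then an
  estimator gets that bit wrong with constant probability on average over \<open>B\<close>
  (\<open>assouad_average\<close>), so that for some \<open>B\<close> its expected excess risk is of order \<open>H p m\<close>.

  The effect of the missing labels is that a constant propensity \<open>c\<close> turns the regression
  function \<open>\<eta>\<close> of \<open>(X, Y)\<close> into the regression function \<open>c \<eta>\<close> of \<open>(X, S)\<close>
  (\<open>observed_law_labelled_law\<close>). Two Bernoulli laws with parameters \<open>c (1 \<plusminus> H) / 2\<close> are at a
  squared distance of order only \<open>c H\<^sup>2\<close> instead of \<open>H\<^sup>2\<close> (\<open>triangular_discrimination_margin\<close>), so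
  that one observation carries information of order \<open>p c H\<^sup>2\<close> about a bit. With
  \<open>p = 1 / (32 n c H\<^sup>2)\<close> the \<open>n\<close> observations together do not determine the bit, and the risk is
  of order \<open>H p m\<close>, which is \<open>m / (n c H)\<close>. The masses fit into a probability distribution as soon
  as \<open>m p \<le> 1\<close>, which holds for \<open>H \<ge> h'\<close>. For \<open>h \<ge> h'\<close> one takes \<open>H = h\<close>; for \<open>h \<le> h'\<close> one
  takes \<open>H = h'\<close>, since a larger margin only shrinks the class of distributions.

  Indistinguishability of two sample laws is measured through their midpoint. Relative to it,
  both laws have densities \<open>1 \<plusminus> u\<close> with \<open>\<bar>u\<bar> \<le> 1\<close>, so that all second moments exist even
  when the two laws are not absolutely continuous with respect to each other (which happens
  for \<open>H = 1\<close>), and the second moment of a product density is the product of the second moments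
  (\<open>two_point_testing\<close>).
\<close>

section \<open>Testing between two product measures\<close>

lemma PiM_density:
  fixes f :: "'a \<Rightarrow> real"
  assumes M: "prob_space M" and f[measurable]: "f \<in> borel_measurable M"
    and f0: "\<And>x. 0 \<le> f x" and P: "prob_space (density M f)"
  shows "(\<Pi>\<^sub>M i\<in>{..<n::nat}. density M f) =
    density (\<Pi>\<^sub>M i\<in>{..<n}. M) (\<lambda>x. \<Prod>i<n. f (x i))"
proof -
  interpret M: product_prob_space "\<lambda>_. M" "{..<n}"
    using M by (simp add: product_prob_space_def product_prob_space_axioms_def
      product_sigma_finite_def prob_space_imp_sigma_finite)
  interpret P: product_prob_space "\<lambda>_. density M f" "{..<n}"
    using P by (simp add: product_prob_space_def product_prob_space_axioms_def
      product_sigma_finite_def prob_space_imp_sigma_finite)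
  show ?thesis
  proof (rule P.PiM_eqI[symmetric])
    show "sets (density (\<Pi>\<^sub>M i\<in>{..<n}. M) (\<lambda>x. \<Prod>i<n. f (x i))) = sets (\<Pi>\<^sub>M i\<in>{..<n}. density M f)"
      by (simp cong: sets_PiM_cong)
    fix A :: "nat \<Rightarrow> 'a set"
    assume "\<And>i. i \<in> {..<n} \<Longrightarrow> A i \<in> sets (density M f)"
    then have A: "i < n \<Longrightarrow> A i \<in> sets M" for i by simp
    then have PA: "Pi\<^sub>E {..<n} A \<in> sets (\<Pi>\<^sub>M i\<in>{..<n}. M)"
      by (intro sets_PiM_I_finite) auto
    have "emeasure (density (\<Pi>\<^sub>M i\<in>{..<n}. M) (\<lambda>x. \<Prod>i<n. f (x i))) (Pi\<^sub>E {..<n} A) =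
        (\<integral>\<^sup>+x. ennreal (\<Prod>i<n. f (x i)) * indicator (Pi\<^sub>E {..<n} A) x \<partial>\<Pi>\<^sub>M i\<in>{..<n}. M)"
      by (rule emeasure_density) (use PA in auto)
    also have "\<dots> = (\<integral>\<^sup>+x. (\<Prod>i<n. ennreal (f (x i)) * indicator (A i) (x i)) \<partial>\<Pi>\<^sub>M i\<in>{..<n}. M)"
    proof (rule nn_integral_cong)
      fix x assume "x \<in> space (\<Pi>\<^sub>M i\<in>{..<n}. M)"
      then have x: "x \<in> extensional {..<n}" by (simp add: space_PiM PiE_def)
      have "indicator (Pi\<^sub>E {..<n} A) x = (\<Prod>i<n. indicator (A i) (x i) :: ennreal)"
        using x by (auto simp: indicator_def PiE_def Pi_iff prod_zero_iff intro: prod.neutral split: if_splits)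
      then show "ennreal (\<Prod>i<n. f (x i)) * indicator (Pi\<^sub>E {..<n} A) x =
          (\<Prod>i<n. ennreal (f (x i)) * indicator (A i) (x i))"
        by (simp add: prod.distrib prod_ennreal f0)
    qed
    also have "\<dots> = (\<Prod>i<n. \<integral>\<^sup>+x. ennreal (f x) * indicator (A i) x \<partial>M)"
      by (rule M.product_nn_integral_prod) (use A in auto)
    also have "\<dots> = (\<Prod>i<n. emeasure (density M f) (A i))"
      by (intro prod.cong) (use A in \<open>auto simp: emeasure_density\<close>)
    finally show "emeasure (density (\<Pi>\<^sub>M i\<in>{..<n}. M) (\<lambda>x. \<Prod>i<n. f (x i))) (Pi\<^sub>E {..<n} A) =
        (\<Prod>i<n. emeasure (density M f) (A i))" .
  qed simp
qed

text \<open>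
  The two measures of \<open>A\<close> differ by \<open>\<integral>(L - 1) 1\<^sub>A\<close>. Since variances are nonnegative, the square
  of this difference is at most \<open>\<integral>(L - 1)\<^sup>2 = \<integral>L\<^sup>2 - 1\<close>.
\<close>

lemma measure_density_ge_chi_square:
  fixes L :: "'a \<Rightarrow> real"
  assumes M: "prob_space M" and [measurable]: "L \<in> borel_measurable M"
    and L0: "\<And>x. 0 \<le> L x" and LB: "\<And>x. L x \<le> B"
    and L1: "(\<integral>x. L x \<partial>M) = 1" and L2: "(\<integral>x. (L x)\<^sup>2 \<partial>M) \<le> 1 + c\<^sup>2" and c: "0 \<le> c"
    and A[measurable]: "A \<in> sets M"
  shows "measure (density M L) A \<ge> measure M A - c"
proof -
  interpret prob_space M by fact
  have bd: "\<bar>L x\<bar> \<le> B" for x using L0[of x] LB[of x] by simp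
  have [simp]: "integrable M L"
    by (rule integrable_const_bound[where B=B]) (use bd in auto)
  have [simp]: "integrable M (\<lambda>x. (L x)\<^sup>2)"
    by (rule integrable_const_bound[where B="B\<^sup>2"]) (use bd in \<open>auto simp: abs_le_square_iff[symmetric] intro!: AE_I2 intro: order_trans[OF _ abs_ge_self]\<close>)
  define f where "f x = indicator A x * (L x - 1)" for x
  have [measurable]: "f \<in> borel_measurable M" unfolding f_def by measurable
  have fb: "\<bar>f x\<bar> \<le> B + 1" for x
    using L0[of x] LB[of x] by (auto simp: f_def indicator_def)
  have [simp]: "integrable M f"
    by (rule integrable_const_bound[where B="B+1"]) (use fb in auto)
  have f2[simp]: "integrable M (\<lambda>x. (f x)\<^sup>2)"
    by (rule integrable_const_bound[where B="(B+1)\<^sup>2"])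
      (use fb in \<open>auto simp: abs_le_square_iff[symmetric] intro: order_trans[OF _ abs_ge_self]\<close>)
  have "emeasure (density M L) A = (\<integral>\<^sup>+x. ennreal (L x * indicator A x) \<partial>M)"
    by (subst emeasure_density) (auto intro!: nn_integral_cong simp: indicator_def)
  also have "\<dots> = ennreal (\<integral>x. L x * indicator A x \<partial>M)"
    by (rule nn_integral_eq_integral) (auto simp: L0 integrable_real_mult_indicator)
  finally have "measure (density M L) A = (\<integral>x. L x * indicator A x \<partial>M)"
    by (simp add: measure_def integral_nonneg_AE L0)
  also have "\<dots> = (\<integral>x. f x + indicator A x \<partial>M)"
    by (rule Bochner_Integration.integral_cong) (auto simp: f_def algebra_simps)
  also have "\<dots> = (\<integral>x. f x \<partial>M) + measure M A"
    by (subst Bochner_Integration.integral_add) (auto simp: integrable_indicator_iff less_top[symmetric])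
  finally have eq: "measure (density M L) A = (\<integral>x. f x \<partial>M) + measure M A" .
  have "0 \<le> variance f" by (rule variance_positive)
  then have "(\<integral>x. f x \<partial>M)\<^sup>2 \<le> (\<integral>x. (f x)\<^sup>2 \<partial>M)"
    by (subst (asm) variance_eq) auto
  also have "\<dots> \<le> (\<integral>x. (L x)\<^sup>2 - 2 * L x + 1 \<partial>M)"
  proof (rule integral_mono)
    show "(f x)\<^sup>2 \<le> (L x)\<^sup>2 - 2 * L x + 1" for x
      using zero_le_power2[of "L x - 1"] by (auto simp: f_def indicator_def power2_diff)
  qed auto
  also have "\<dots> = (\<integral>x. (L x)\<^sup>2 \<partial>M) - 2 * (\<integral>x. L x \<partial>M) + 1"
    by (subst Bochner_Integration.integral_add Bochner_Integration.integral_diff, simp, simp)+ (simp add: prob_space)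
  also have "\<dots> \<le> c\<^sup>2" using L1 L2 by simp
  finally have "\<bar>\<integral>x. f x \<partial>M\<bar> \<le> c" using c by (metis abs_le_square_iff abs_of_nonneg)
  then show ?thesis using eq by linarith
qed

text \<open>
  The second moment of the product density is \<open>(1 + \<integral>u\<^sup>2)\<^sup>n \<le> exp (n \<integral>u\<^sup>2)\<close>. The bound
  \<open>1/32\<close> makes this at most \<open>1 + 1/16\<close>, which is where the loss \<open>1/4\<close> comes from.
\<close>

lemma measure_PiM_density_ge:
  fixes u :: "'a \<Rightarrow> real"
  assumes M: "prob_space M" and u[measurable]: "u \<in> borel_measurable M"
    and u1: "\<And>x. \<bar>u x\<bar> \<le> 1" and u0: "(\<integral>x. u x \<partial>M) = 0"
    and v: "real n * (\<integral>x. (u x)\<^sup>2 \<partial>M) \<le> 1/32"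
    and P: "prob_space (density M (\<lambda>x. 1 + u x))"
    and A: "A \<in> sets (\<Pi>\<^sub>M i\<in>{..<n::nat}. M)"
  shows "measure (\<Pi>\<^sub>M i\<in>{..<n}. density M (\<lambda>x. 1 + u x)) A \<ge>
    measure (\<Pi>\<^sub>M i\<in>{..<n}. M) A - 1/4"
proof -
  interpret M: prob_space M by fact
  interpret PM: product_prob_space "\<lambda>_. M" "{..<n}"
    using M by (simp add: product_prob_space_def product_prob_space_axioms_def
      product_sigma_finite_def prob_space_imp_sigma_finite)
  have pos: "0 \<le> 1 + u x" and le2: "1 + u x \<le> 2" for x using u1[of x] by linarith+
  have iu[simp]: "integrable M u" "integrable M (\<lambda>x. (u x)\<^sup>2)"
    by (rule M.integrable_const_bound[where B=1]; use u1 in \<open>auto simp: abs_square_le_1\<close>)+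
  define v where "v = (\<integral>x. (u x)\<^sup>2 \<partial>M)"
  have v0: "0 \<le> v" unfolding v_def by simp
  have sq: "(\<lambda>x. (1 + u x)\<^sup>2) = (\<lambda>x. 1 + 2 * u x + (u x)\<^sup>2)"
    by (auto simp: power2_eq_square algebra_simps)
  have int1: "(\<integral>x. 1 + u x \<partial>M) = 1" using u0 by (simp add: M.prob_space)
  have int2: "(\<integral>x. (1 + u x)\<^sup>2 \<partial>M) = 1 + v"
    unfolding sq using u0 by (simp add: M.prob_space v_def)
  show ?thesis
    unfolding PiM_density[OF M _ pos P, of n, simplified]
  proof (rule measure_density_ge_chi_square[where B="2^n"])
    show "prob_space (\<Pi>\<^sub>M i\<in>{..<n}. M)" by (rule prob_space_PiM) (rule M)
    show "(\<Prod>i<n. 1 + u (x i)) \<le> 2 ^ n" for x :: "nat \<Rightarrow> 'a"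
      using prod_mono[of "{..<n}" "\<lambda>i. 1 + u (x i)" "\<lambda>_. 2"] pos le2 by simp
    show "(\<integral>x. (\<Prod>i<n. 1 + u (x i)) \<partial>\<Pi>\<^sub>M i\<in>{..<n}. M) = 1"
      by (subst PM.product_integral_prod) (use int1 in auto)
    have "(\<integral>x. (\<Prod>i<n. 1 + u (x i))\<^sup>2 \<partial>\<Pi>\<^sub>M i\<in>{..<n}. M) = (1 + v) ^ n"
      unfolding prod_power_distrib
      by (subst PM.product_integral_prod) (use int2 in \<open>auto simp: sq\<close>)
    also have "\<dots> \<le> exp v ^ n" by (rule power_mono) (use v0 in auto)
    also have "\<dots> = exp (real n * v)" by (simp add: exp_of_nat_mult)
    also have "\<dots> \<le> 1 + 2 * (real n * v)"
      by (rule real_exp_bound_lemma) (use v0 v in \<open>auto simp: v_def\<close>)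
    also have "\<dots> \<le> 1 + (1/4)\<^sup>2" using v by (simp add: v_def power2_eq_square)
    finally show "(\<integral>x. (\<Prod>i<n. 1 + u (x i))\<^sup>2 \<partial>\<Pi>\<^sub>M i\<in>{..<n}. M) \<le> 1 + (1/4)\<^sup>2" .
  qed (use A pos in \<open>auto intro!: prod_nonneg\<close>)
qed

text \<open>
  The two error probabilities of any test between \<open>n\<close>-fold products sum to at least a constant
  when the triangular discrimination of the factors is a small multiple of \<open>1/n\<close>. Both products are
  compared with the product of the midpoint \<open>M\<close>; the factors have densities \<open>1 + u\<close> and
  \<open>1 - u\<close> with respect to \<open>M\<close>, and \<open>\<integral>u\<^sup>2 dM\<close> is the integral in the hypothesis. Where both
  densities vanish, \<open>u = 0\<close> by the convention for division by zero.
\<close>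

lemma two_point_testing:
  fixes f g :: "'a \<Rightarrow> real"
  assumes f[measurable]: "f \<in> borel_measurable N" and g[measurable]: "g \<in> borel_measurable N"
    and f0: "\<And>x. 0 \<le> f x" and g0: "\<And>x. 0 \<le> g x"
    and P: "prob_space (density N f)" and Q: "prob_space (density N g)"
    and close: "real n * (\<integral>x. (f x - g x)\<^sup>2 / (2 * (f x + g x)) \<partial>N) \<le> 1/32"
    and A: "A \<in> sets (\<Pi>\<^sub>M i\<in>{..<n::nat}. N)"
  shows "measure (\<Pi>\<^sub>M i\<in>{..<n}. density N f) A +
    measure (\<Pi>\<^sub>M i\<in>{..<n}. density N g) (space (\<Pi>\<^sub>M i\<in>{..<n}. N) - A) \<ge> 1/2"
proof -
  define m where "m x = (f x + g x) / 2" for x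
  define u where "u x = (f x - g x) / (f x + g x)" for x
  define M where "M = density N m"
  have [measurable]: "m \<in> borel_measurable N" "u \<in> borel_measurable N"
    unfolding m_def u_def by measurable
  have m0: "0 \<le> m x" for x using f0[of x] g0[of x] by (simp add: m_def)
  have u1: "\<bar>u x\<bar> \<le> 1" for x using f0[of x] g0[of x] by (auto simp: u_def divide_simps abs_if)
  have mf: "m x * (1 + u x) = f x" and mg: "m x * (1 + - u x) = g x" for x
  proof -
    have u: "(f x + g x) * u x = f x - g x"
      using f0[of x] g0[of x] by (auto simp: u_def add_nonneg_eq_0_iff)
    show "m x * (1 + u x) = f x" "m x * (1 + - u x) = g x"
      using u unfolding m_def by argo+
  qed
  have uM: "u \<in> borel_measurable M" "(\<lambda>x. - u x) \<in> borel_measurable M" by (auto simp: M_def)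
  have nnf: "(\<integral>\<^sup>+x. f x \<partial>N) = 1" and nng: "(\<integral>\<^sup>+x. g x \<partial>N) = 1"
    using prob_space.emeasure_space_1[OF P] prob_space.emeasure_space_1[OF Q]
    by (auto simp: emeasure_density cong: nn_integral_cong)
  have if1: "integrable N f" "(\<integral>x. f x \<partial>N) = 1" and ig1: "integrable N g" "(\<integral>x. g x \<partial>N) = 1"
    using nnf nng f0 g0 by (auto simp: integrable_iff_bounded integral_eq_nn_integral)
  have "(\<integral>\<^sup>+x. m x \<partial>N) = ennreal (\<integral>x. m x \<partial>N)"
    by (rule nn_integral_eq_integral) (use if1 ig1 m0 in \<open>auto simp: m_def\<close>)
  also have "\<dots> = 1" using if1 ig1 by (simp add: m_def)
  finally have M: "prob_space M"
    by (intro prob_spaceI) (simp add: M_def emeasure_density cong: nn_integral_cong)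
  have df: "density M (\<lambda>x. 1 + u x) = density N f"
    unfolding M_def by (subst density_density_eq) (use m0 mf in \<open>auto simp: ennreal_mult'[symmetric]\<close>)
  have dg: "density M (\<lambda>x. 1 + - u x) = density N g"
    unfolding M_def by (subst density_density_eq) (use m0 mg in \<open>auto simp: ennreal_mult'[symmetric]\<close>)
  have u0: "(\<integral>x. u x \<partial>M) = 0"
  proof -
    have "(\<integral>x. u x \<partial>M) = (\<integral>x. m x * u x \<partial>N)"
      unfolding M_def by (subst integral_density) (use m0 in auto)
    also have "\<dots> = (\<integral>x. f x / 2 - g x / 2 \<partial>N)"
    proof (rule Bochner_Integration.integral_cong)
      show "m x * u x = f x / 2 - g x / 2" for x
        using mf[of x] unfolding m_def by argo
    qed simp
    also have "\<dots> = 0" using if1 ig1 by simp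
    finally show ?thesis .
  qed
  have "(\<integral>x. (u x)\<^sup>2 \<partial>M) = (\<integral>x. m x * (u x)\<^sup>2 \<partial>N)"
    unfolding M_def by (subst integral_density) (use m0 in auto)
  also have "\<dots> = (\<integral>x. (f x - g x)\<^sup>2 / (2 * (f x + g x)) \<partial>N)"
    by (rule Bochner_Integration.integral_cong) (auto simp: m_def u_def power2_eq_square)
  finally have v: "real n * (\<integral>x. (u x)\<^sup>2 \<partial>M) \<le> 1/32" using close by simp
  let ?S = "\<Pi>\<^sub>M i\<in>{..<n}. M"
  interpret S: prob_space ?S by (rule prob_space_PiM) (rule M)
  have sets_S: "sets ?S = sets (\<Pi>\<^sub>M i\<in>{..<n}. N)"
    by (rule sets_PiM_cong) (auto simp: M_def)
  note space_S = sets_eq_imp_space_eq[OF sets_S]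
  have A': "A \<in> sets ?S" "space ?S - A \<in> sets ?S" using A sets_S by auto
  have "measure (\<Pi>\<^sub>M i\<in>{..<n}. density N f) A \<ge> measure ?S A - 1/4"
    using measure_PiM_density_ge[OF M uM(1) u1 u0 v _ A'(1)] P by (simp add: df)
  moreover have "measure (\<Pi>\<^sub>M i\<in>{..<n}. density N g) (space ?S - A) \<ge> measure ?S (space ?S - A) - 1/4"
    using measure_PiM_density_ge[OF M uM(2) _ _ _ _ A'(2)] u1 u0 v Q by (simp only: dg) simp
  moreover have "measure ?S (space ?S - A) = 1 - measure ?S A"
    by (rule S.prob_compl) (rule A')
  ultimately show ?thesis by (simp add: space_S)
qed

section \<open>Laws with a prescribed regression function\<close>

text \<open>
  The law of \<open>(X, Y)\<close> when \<open>X\<close> has law \<open>\<mu>\<close> and \<open>Y\<close> is Bernoulli with parameter \<open>\<eta> x\<close> given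
  \<open>X = x\<close>.
\<close>

definition labelled_law :: "'a measure \<Rightarrow> ('a \<Rightarrow> real) \<Rightarrow> ('a \<times> bool) measure" where
  "labelled_law \<mu> \<eta> = density (\<mu> \<Otimes>\<^sub>M count_space UNIV) (\<lambda>(x, y). ennreal (if y then \<eta> x else 1 - \<eta> x))"

lemma sets_labelled_law [measurable_cong]:
  "sets (labelled_law \<mu> \<eta>) = sets (\<mu> \<Otimes>\<^sub>M count_space UNIV)"
  by (simp add: labelled_law_def)

lemma space_labelled_law: "space (labelled_law \<mu> \<eta>) = space \<mu> \<times> UNIV"
  by (simp add: labelled_law_def space_pair_measure)

lemma nn_integral_pair_bool:
  assumes [measurable]: "f \<in> borel_measurable (\<mu> \<Otimes>\<^sub>M count_space (UNIV :: bool set))"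
  shows "(\<integral>\<^sup>+z. f z \<partial>(\<mu> \<Otimes>\<^sub>M count_space UNIV)) = (\<integral>\<^sup>+x. f (x, True) + f (x, False) \<partial>\<mu>)"
proof -
  interpret sigma_finite_measure "count_space (UNIV :: bool set)"
    by (rule sigma_finite_measure_count_space_finite) simp
  show ?thesis
    by (subst nn_integral_fst[OF assms, symmetric])
      (auto simp: nn_integral_count_space_finite UNIV_bool add.commute)
qed

lemma nn_integral_labelled_law:
  assumes [measurable]: "\<eta> \<in> borel_measurable \<mu>"
    and [measurable]: "f \<in> borel_measurable (\<mu> \<Otimes>\<^sub>M count_space UNIV)"
  shows "(\<integral>\<^sup>+z. f z \<partial>labelled_law \<mu> \<eta>) =
    (\<integral>\<^sup>+x. ennreal (\<eta> x) * f (x, True) + ennreal (1 - \<eta> x) * f (x, False) \<partial>\<mu>)"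
  unfolding labelled_law_def
  by (subst nn_integral_density; simp add: nn_integral_pair_bool)

lemma integral_labelled_law:
  assumes [measurable]: "\<eta> \<in> borel_measurable \<mu>"
    and \<eta>: "\<And>x. x \<in> space \<mu> \<Longrightarrow> 0 \<le> \<eta> x \<and> \<eta> x \<le> 1"
    and [measurable]: "f \<in> borel_measurable (\<mu> \<Otimes>\<^sub>M count_space UNIV)" and f0: "\<And>z. 0 \<le> f z"
  shows "(\<integral>z. f z \<partial>labelled_law \<mu> \<eta>) =
    (\<integral>x. \<eta> x * f (x, True) + (1 - \<eta> x) * f (x, False) \<partial>\<mu>)"
proof -
  have [measurable]: "f \<in> borel_measurable (labelled_law \<mu> \<eta>)"
    by (simp add: labelled_law_def)
  have "(\<integral>z. f z \<partial>labelled_law \<mu> \<eta>) = enn2real (\<integral>\<^sup>+z. ennreal (f z) \<partial>labelled_law \<mu> \<eta>)"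
    by (rule integral_eq_nn_integral) (use f0 in auto)
  also have "(\<integral>\<^sup>+z. ennreal (f z) \<partial>labelled_law \<mu> \<eta>) =
      (\<integral>\<^sup>+x. ennreal (\<eta> x * f (x, True) + (1 - \<eta> x) * f (x, False)) \<partial>\<mu>)"
    by (subst nn_integral_labelled_law)
      (auto intro!: nn_integral_cong simp: ennreal_mult f0 \<eta>)
  also have "enn2real \<dots> = (\<integral>x. \<eta> x * f (x, True) + (1 - \<eta> x) * f (x, False) \<partial>\<mu>)"
    by (rule integral_eq_nn_integral[symmetric]) (use f0 \<eta> in auto)
  finally show ?thesis .
qed

lemma prob_space_labelled_law:
  assumes "prob_space \<mu>" and [measurable]: "\<eta> \<in> borel_measurable \<mu>"
    and \<eta>: "\<And>x. x \<in> space \<mu> \<Longrightarrow> 0 \<le> \<eta> x \<and> \<eta> x \<le> 1"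
  shows "prob_space (labelled_law \<mu> \<eta>)"
proof (rule prob_spaceI)
  have "emeasure (labelled_law \<mu> \<eta>) (space (labelled_law \<mu> \<eta>)) = (\<integral>\<^sup>+z. 1 \<partial>labelled_law \<mu> \<eta>)"
    by simp
  also have "\<dots> = (\<integral>\<^sup>+x. 1 \<partial>\<mu>)"
    by (subst nn_integral_labelled_law)
      (auto intro!: nn_integral_cong simp: \<eta> ennreal_plus[symmetric] simp del: nn_integral_const ennreal_plus)
  also have "\<dots> = 1" using prob_space.emeasure_space_1[OF assms(1)] by simp
  finally show "emeasure (labelled_law \<mu> \<eta>) (space (labelled_law \<mu> \<eta>)) = 1" .
qed

text \<open>
  Given \<open>X = x\<close>, the label \<open>S\<close> is \<open>1\<close> exactly when \<open>Y = 1\<close> and the positive example is selected,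
  which has probability \<open>c \<eta> x\<close>. This is the only place where the observation model enters: the
  sample has the same form as a fully labelled one, with a rescaled regression function.
\<close>

lemma observed_law_labelled_law:
  assumes \<mu>: "sets \<mu> = sets (Rd d)" and [measurable]: "\<eta> \<in> borel_measurable \<mu>"
    and \<eta>: "\<And>x. x \<in> space \<mu> \<Longrightarrow> 0 \<le> \<eta> x \<and> \<eta> x \<le> 1"
    and c: "0 \<le> c" "c \<le> 1" and e: "\<And>x. x \<in> space (Rd d) \<Longrightarrow> e x = c"
  shows "observed_law d e (labelled_law \<mu> \<eta>) = labelled_law \<mu> (\<lambda>x. c * \<eta> x)"
proof (rule measure_eqI)
  note [measurable_cong] = \<mu>
  have ls: "sets (labelled_space d) = sets (\<mu> \<Otimes>\<^sub>M count_space UNIV)"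
    unfolding labelled_space_def using \<mu> by (intro sets_pair_measure_cong) auto
  show "sets (observed_law d e (labelled_law \<mu> \<eta>)) = sets (labelled_law \<mu> (\<lambda>x. c * \<eta> x))"
    by (simp add: observed_law_def ls sets_labelled_law)
  have sp: "space \<mu> = space (Rd d)" using \<mu> by (rule sets_eq_imp_space_eq)
  fix A assume "A \<in> sets (observed_law d e (labelled_law \<mu> \<eta>))"
  then have A[measurable]: "A \<in> sets (\<mu> \<Otimes>\<^sub>M count_space UNIV)"
    by (simp add: observed_law_def ls)
  define w where "w y s = (if y then if s then c else 1 - c else if s then 0 else 1)" for y s :: bool
  have w: "pmf (bernoulli_pmf c) s = w True s" "pmf (bernoulli_pmf 0) s = w False s" for s
    by (cases s; use c in \<open>simp add: w_def\<close>)+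
  let ?J = "density (labelled_law \<mu> \<eta> \<Otimes>\<^sub>M count_space UNIV) (\<lambda>((x, y), s). ennreal (w y s))"
  let ?F = "\<lambda>((x :: nat \<Rightarrow> real, y :: bool), s :: bool). (x, s)"
  have w_m[measurable]: "(\<lambda>((x, y), s). ennreal (w y s)) \<in>
      borel_measurable (labelled_law \<mu> \<eta> \<Otimes>\<^sub>M count_space UNIV)"
    unfolding w_def case_prod_beta' by measurable
  have wA_m: "(\<lambda>((x, y), s). ennreal (w y s) * indicator A (x, s)) \<in>
      borel_measurable (labelled_law \<mu> \<eta> \<Otimes>\<^sub>M count_space UNIV)"
    unfolding w_def case_prod_beta' by measurable
  have J: "pu_joint_law e (labelled_law \<mu> \<eta>) = ?J"
    unfolding pu_joint_law_def
  proof (rule density_cong)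
    show "(\<lambda>((x, y), s). ennreal (pmf (bernoulli_pmf (if y then e x else 0)) s)) \<in>
        borel_measurable (labelled_law \<mu> \<eta> \<Otimes>\<^sub>M count_space UNIV)"
      by (rule measurable_cong[THEN iffD2, OF _ w_m])
        (auto simp: space_pair_measure space_labelled_law sp e w)
  qed (auto simp: space_pair_measure space_labelled_law sp e w w_m)
  have F[measurable]: "?F \<in> (labelled_law \<mu> \<eta> \<Otimes>\<^sub>M count_space UNIV) \<rightarrow>\<^sub>M (\<mu> \<Otimes>\<^sub>M count_space UNIV)"
    unfolding case_prod_beta' by measurable
  have [measurable]: "?F \<in> ?J \<rightarrow>\<^sub>M labelled_space d"
    using F by (simp add: measurable_cong_sets[OF refl ls])
  have "emeasure (observed_law d e (labelled_law \<mu> \<eta>)) A =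
      (\<integral>\<^sup>+z. indicator A z \<partial>distr ?J (labelled_space d) ?F)"
    using A by (simp add: observed_law_def J ls)
  also have "\<dots> = (\<integral>\<^sup>+w. indicator A (?F w) \<partial>?J)"
    by (rule nn_integral_distr) (use A in \<open>auto simp: measurable_cong_sets[OF ls refl]\<close>)
  also have "\<dots> = (\<integral>\<^sup>+((x, y), s). ennreal (w y s) * indicator A (x, s)
      \<partial>(labelled_law \<mu> \<eta> \<Otimes>\<^sub>M count_space UNIV))"
    by (subst nn_integral_density) (auto simp: case_prod_beta')
  also have "\<dots> = (\<integral>\<^sup>+(x, y). ennreal (if y then c else 0) * indicator A (x, True) +
      ennreal (if y then 1 - c else 1) * indicator A (x, False) \<partial>labelled_law \<mu> \<eta>)"
    by (subst nn_integral_pair_bool[OF wA_m]) (auto intro!: nn_integral_cong simp: w_def)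
  also have "\<dots> = (\<integral>\<^sup>+x. ennreal (c * \<eta> x) * indicator A (x, True) + ennreal (1 - c * \<eta> x) * indicator A (x, False) \<partial>\<mu>)"
  proof (subst nn_integral_labelled_law)
    show "(\<integral>\<^sup>+x. ennreal (\<eta> x) * (case (x, True) of (x, y) \<Rightarrow> ennreal (if y then c else 0) * indicator A (x, True) +
          ennreal (if y then 1 - c else 1) * indicator A (x, False)) +
        ennreal (1 - \<eta> x) * (case (x, False) of (x, y) \<Rightarrow> ennreal (if y then c else 0) * indicator A (x, True) +
          ennreal (if y then 1 - c else 1) * indicator A (x, False)) \<partial>\<mu>) =
      (\<integral>\<^sup>+x. ennreal (c * \<eta> x) * indicator A (x, True) + ennreal (1 - c * \<eta> x) * indicator A (x, False) \<partial>\<mu>)"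
    proof (rule nn_integral_cong)
      fix x assume x: "x \<in> space \<mu>"
      have split: "1 - c * \<eta> x = \<eta> x * (1 - c) + (1 - \<eta> x)" by (simp add: algebra_simps)
      have "ennreal (1 - c * \<eta> x) = ennreal (\<eta> x) * ennreal (1 - c) + ennreal (1 - \<eta> x)"
        unfolding split using \<eta>[OF x] c by (subst ennreal_plus) (auto simp: ennreal_mult)
      moreover have "ennreal (c * \<eta> x) = ennreal (\<eta> x) * ennreal c"
        using \<eta>[OF x] c by (simp add: ennreal_mult mult.commute)
      ultimately show "ennreal (\<eta> x) * (case (x, True) of (x, y) \<Rightarrow> ennreal (if y then c else 0) * indicator A (x, True) +
          ennreal (if y then 1 - c else 1) * indicator A (x, False)) +
        ennreal (1 - \<eta> x) * (case (x, False) of (x, y) \<Rightarrow> ennreal (if y then c else 0) * indicator A (x, True) +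
          ennreal (if y then 1 - c else 1) * indicator A (x, False)) =
        ennreal (c * \<eta> x) * indicator A (x, True) + ennreal (1 - c * \<eta> x) * indicator A (x, False)"
        by (simp add: algebra_simps)
    qed
  qed auto
  also have "\<dots> = (\<integral>\<^sup>+z. indicator A z \<partial>labelled_law \<mu> (\<lambda>x. c * \<eta> x))"
    by (rule nn_integral_labelled_law[symmetric]) auto
  also have "\<dots> = emeasure (labelled_law \<mu> (\<lambda>x. c * \<eta> x)) A"
    using A by (simp add: sets_labelled_law)
  finally show "emeasure (observed_law d e (labelled_law \<mu> \<eta>)) A =
    emeasure (labelled_law \<mu> (\<lambda>x. c * \<eta> x)) A" .
qed

lemma is_regression_function_labelled_law:
  assumes \<mu>: "prob_space \<mu>" "sets \<mu> = sets (Rd d)" and \<eta>m: "\<eta> \<in> borel_measurable (Rd d)"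
    and \<eta>: "\<And>x. x \<in> space (Rd d) \<Longrightarrow> 0 \<le> \<eta> x \<and> \<eta> x \<le> 1"
  shows "is_regression_function d (labelled_law \<mu> \<eta>) \<eta>"
proof -
  note [measurable_cong] = \<mu>(2)
  have [measurable]: "\<eta> \<in> borel_measurable \<mu>" using \<eta>m by measurable
  have sp: "space \<mu> = space (Rd d)" using \<mu>(2) by (rule sets_eq_imp_space_eq)
  let ?P = "labelled_law \<mu> \<eta>"
  let ?F = "vimage_algebra (space ?P) fst (Rd d)"
  interpret P: prob_space ?P
    by (rule prob_space_labelled_law) (use \<mu> \<eta> sp in auto)
  have fst_P: "fst \<in> ?P \<rightarrow>\<^sub>M Rd d" by measurable
  have "subalgebra ?P ?F"
    unfolding subalgebra_def
    using measurable_iff_sets[of fst ?P "Rd d"] fst_P by (auto simp: space_labelled_law sp)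
  then interpret finite_measure_subalgebra ?P ?F by unfold_locales
  have "AE z in ?P. real_cond_exp ?P ?F (\<lambda>z. of_bool (snd z)) z = \<eta> (fst z)"
  proof (rule real_cond_exp_charact)
    fix A assume "A \<in> sets ?F"
    then obtain B where B[measurable]: "B \<in> sets (Rd d)" and A: "A = fst -` B \<inter> space ?P"
      by (subst (asm) sets_vimage_algebra2) (auto simp: space_labelled_law sp)
    have "(\<integral>z\<in>A. (of_bool (snd z) :: real) \<partial>?P) = (\<integral>z. indicator B (fst z) * of_bool (snd z) \<partial>?P)"
      unfolding set_lebesgue_integral_def
      by (rule Bochner_Integration.integral_cong) (auto simp: A indicator_def)
    also have "\<dots> = (\<integral>x. \<eta> x * indicator B x \<partial>\<mu>)"
      by (subst integral_labelled_law) (use \<eta> sp in \<open>auto\<close>)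
    \<comment> \<open>Outside the space \<open>\<eta>\<close> may be negative; the truncation makes the integrand nonnegative everywhere.\<close>
    also have "\<dots> = (\<integral>x. \<eta> x * (indicator B x * max 0 (\<eta> x)) + (1 - \<eta> x) * (indicator B x * max 0 (\<eta> x)) \<partial>\<mu>)"
      by (rule Bochner_Integration.integral_cong) (use \<eta> sp in \<open>auto simp: algebra_simps indicator_def max_def\<close>)
    also have "\<dots> = (\<integral>z. indicator B (fst z) * max 0 (\<eta> (fst z)) \<partial>?P)"
      by (subst integral_labelled_law) (use \<eta> sp in auto)
    also have "\<dots> = (\<integral>z\<in>A. \<eta> (fst z) \<partial>?P)"
      unfolding set_lebesgue_integral_def
      by (rule Bochner_Integration.integral_cong) (use \<eta> sp in \<open>auto simp: A indicator_def space_labelled_law\<close>)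
    finally show "(\<integral>z\<in>A. of_bool (snd z) \<partial>?P) = (\<integral>z\<in>A. \<eta> (fst z) \<partial>?P)" .
  next
    show "integrable ?P (\<lambda>z. of_bool (snd z) :: real)"
      by (rule P.integrable_const_bound[where B=1]) auto
    show "integrable ?P (\<lambda>z. \<eta> (fst z))"
      by (rule P.integrable_const_bound[where B=1])
        (use \<eta> sp in \<open>auto simp: space_labelled_law intro!: AE_I2\<close>)
    show "(\<lambda>z. \<eta> (fst z)) \<in> borel_measurable ?F"
      by (rule measurable_compose[OF measurable_vimage_algebra1 \<eta>m])
        (auto simp: space_labelled_law sp)
  qed
  then show ?thesis unfolding is_regression_function_def using \<eta>m \<eta> by auto
qed

text \<open>
  Any two regression functions agree almost everywhere, and so do their Bayes classifiers;
  hence the version chosen in the definition of the excess risk can be replaced by a convenient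
  one.
\<close>

lemma excess_risk_eq:
  assumes P: "P \<in> distributions d" and \<eta>: "is_regression_function d P \<eta>"
  shows "excess_risk d P g = risk P g - risk P (bayes_classifier \<eta>)"
proof -
  define \<eta>' where "\<eta>' = (SOME \<eta>. is_regression_function d P \<eta>)"
  have \<eta>': "is_regression_function d P \<eta>'"
    using someI[of "is_regression_function d P", OF \<eta>] by (simp add: \<eta>'_def)
  have [measurable_cong]: "sets P = sets (Rd d \<Otimes>\<^sub>M count_space UNIV)"
    using P by (simp add: distributions_def labelled_space_def)
  have [measurable]: "\<eta> \<in> borel_measurable (Rd d)" "\<eta>' \<in> borel_measurable (Rd d)"
    using \<eta> \<eta>' by (auto simp: is_regression_function_def)
  have "AE z in P. \<eta> (fst z) = \<eta>' (fst z)"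
    using \<eta> \<eta>' unfolding is_regression_function_def by fastforce
  then have "risk P (bayes_classifier \<eta>) = risk P (bayes_classifier \<eta>')"
    unfolding risk_def bayes_classifier_def by (intro measure_eq_AE) auto
  then show ?thesis by (simp add: excess_risk_def \<eta>'_def)
qed

lemma risk_labelled_law:
  assumes \<mu>: "prob_space \<mu>" and [measurable]: "\<eta> \<in> borel_measurable \<mu>" "g \<in> \<mu> \<rightarrow>\<^sub>M count_space UNIV"
    and \<eta>: "\<And>x. x \<in> space \<mu> \<Longrightarrow> 0 \<le> \<eta> x \<and> \<eta> x \<le> 1"
  shows "risk (labelled_law \<mu> \<eta>) g = (\<integral>x. (if g x then 1 - \<eta> x else \<eta> x) \<partial>\<mu>)"
proof -
  interpret P: prob_space "labelled_law \<mu> \<eta>"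
    by (rule prob_space_labelled_law) (use assms in auto)
  have "risk (labelled_law \<mu> \<eta>) g =
      (\<integral>z. indicator {z \<in> space (labelled_law \<mu> \<eta>). g (fst z) \<noteq> snd z} z \<partial>labelled_law \<mu> \<eta>)"
    unfolding risk_def by (simp add: P.emeasure_eq_measure)
  also have "\<dots> = (\<integral>z. of_bool (g (fst z) \<noteq> snd z) \<partial>labelled_law \<mu> \<eta>)"
    by (rule Bochner_Integration.integral_cong) auto
  also have "\<dots> = (\<integral>x. (if g x then 1 - \<eta> x else \<eta> x) \<partial>\<mu>)"
    by (subst integral_labelled_law) (use \<eta> in \<open>auto intro!: Bochner_Integration.integral_cong\<close>)
  finally show ?thesis .
qed

text \<open>
  The regression function with Bayes classifier \<open>g\<close> for which the margin \<open>\<bar>2 \<eta> - 1\<bar>\<close> equals \<open>h\<close>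
  everywhere.
\<close>

definition margin_regression :: "real \<Rightarrow> ('a \<Rightarrow> bool) \<Rightarrow> 'a \<Rightarrow> real" where
  "margin_regression h g x = (if g x then (1 + h) / 2 else (1 - h) / 2)"

lemma margin_regression_measurable [measurable]:
  "g \<in> M \<rightarrow>\<^sub>M count_space UNIV \<Longrightarrow> margin_regression h g \<in> borel_measurable M"
  unfolding margin_regression_def by measurable

lemma margin_regression_bounds:
  "0 \<le> h \<Longrightarrow> h \<le> 1 \<Longrightarrow> 0 \<le> margin_regression h g x \<and> margin_regression h g x \<le> 1"
  by (simp add: margin_regression_def)

lemma bayes_classifier_margin_regression:
  "0 < h \<Longrightarrow> bayes_classifier (margin_regression h g) = g"
  by (auto simp: bayes_classifier_def margin_regression_def fun_eq_iff)

lemma labelled_law_in_distributions: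
  assumes "prob_space \<mu>" "sets \<mu> = sets (Rd d)" "\<eta> \<in> borel_measurable (Rd d)"
    "\<And>x. x \<in> space (Rd d) \<Longrightarrow> 0 \<le> \<eta> x \<and> \<eta> x \<le> 1"
  shows "labelled_law \<mu> \<eta> \<in> distributions d"
  using assms sets_eq_imp_space_eq[OF assms(2)]
  by (auto simp: distributions_def labelled_space_def sets_labelled_law
      cong: measurable_cong_sets intro!: prob_space_labelled_law sets_pair_measure_cong)

text \<open>
  The margin \<open>h'\<close> of the law may exceed the margin \<open>h\<close> of the class; this covers the regime of
  small \<open>h\<close>, where the worst distributions have a margin that does not depend on \<open>h\<close>.
\<close>

lemma labelled_law_in_margin_class:
  assumes \<mu>: "prob_space \<mu>" "sets \<mu> = sets (Rd d)" and g: "g \<in> Rd d \<rightarrow>\<^sub>M count_space UNIV" "g \<in> G"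
    and h: "0 < h" "h \<le> h'" "h' \<le> 1"
  shows "labelled_law \<mu> (margin_regression h' g) \<in> margin_class d G h"
proof -
  have "is_regression_function d (labelled_law \<mu> (margin_regression h' g)) (margin_regression h' g)"
    by (rule is_regression_function_labelled_law)
      (use \<mu> g h in \<open>auto intro!: margin_regression_measurable simp: margin_regression_bounds\<close>)
  moreover have "\<forall>x. \<bar>2 * margin_regression h' g x - 1\<bar> \<ge> h"
    using h by (auto simp: margin_regression_def field_simps)
  moreover have "labelled_law \<mu> (margin_regression h' g) \<in> distributions d"
    by (rule labelled_law_in_distributions)
      (use \<mu> g h in \<open>auto intro!: margin_regression_measurable simp: margin_regression_bounds\<close>)
  moreover have "\<exists>f\<in>G. \<forall>x\<in>space (Rd d). f x = bayes_classifier (margin_regression h' g) x"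
    using g h by (intro bexI[of _ g]) (simp_all add: bayes_classifier_margin_regression)
  ultimately show ?thesis unfolding margin_class_def by blast
qed

text \<open>
  At a point where \<open>f\<close> disagrees with the Bayes classifier, the conditional error goes up from
  \<open>(1 - h) / 2\<close> to \<open>(1 + h) / 2\<close>.
\<close>

lemma excess_risk_margin_regression:
  assumes \<mu>: "prob_space \<mu>" "sets \<mu> = sets (Rd d)"
    and g: "g \<in> Rd d \<rightarrow>\<^sub>M count_space UNIV" "f \<in> Rd d \<rightarrow>\<^sub>M count_space UNIV"
    and h: "0 < h" "h \<le> 1"
  shows "excess_risk d (labelled_law \<mu> (margin_regression h g)) f =
    h * measure \<mu> {x \<in> space \<mu>. f x \<noteq> g x}"
proof -
  note [measurable_cong] = \<mu>(2)
  interpret prob_space \<mu> by fact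
  let ?\<eta> = "margin_regression h g"
  have m[measurable]: "g \<in> \<mu> \<rightarrow>\<^sub>M count_space UNIV" "f \<in> \<mu> \<rightarrow>\<^sub>M count_space UNIV"
    using g by measurable
  have \<eta>: "0 \<le> ?\<eta> x \<and> ?\<eta> x \<le> 1" for x using h by (simp add: margin_regression_bounds)
  have i: "integrable \<mu> (\<lambda>x. if k x then 1 - ?\<eta> x else ?\<eta> x)"
    if [measurable]: "k \<in> \<mu> \<rightarrow>\<^sub>M count_space UNIV" for k
    by (rule integrable_const_bound[where B=1]) (use \<eta> in \<open>auto simp: abs_le_iff intro!: AE_I2 dest: order_trans\<close>)
  have "excess_risk d (labelled_law \<mu> ?\<eta>) f = risk (labelled_law \<mu> ?\<eta>) f - risk (labelled_law \<mu> ?\<eta>) g"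
    by (subst excess_risk_eq[of _ d ?\<eta>])
      (use \<mu> g h \<eta> in \<open>auto intro!: labelled_law_in_distributions is_regression_function_labelled_law
        margin_regression_measurable simp: bayes_classifier_margin_regression\<close>)
  also have "\<dots> = (\<integral>x. (if f x then 1 - ?\<eta> x else ?\<eta> x) - (if g x then 1 - ?\<eta> x else ?\<eta> x) \<partial>\<mu>)"
    using \<eta> i by (simp add: risk_labelled_law \<mu> m)
  also have "\<dots> = (\<integral>x. h * indicator {x \<in> space \<mu>. f x \<noteq> g x} x \<partial>\<mu>)"
    by (rule Bochner_Integration.integral_cong) (auto simp: margin_regression_def field_simps)
  also have "\<dots> = h * measure \<mu> {x \<in> space \<mu>. f x \<noteq> g x}" by simp
  finally show ?thesis .
qed

section \<open>Testing between two margin distributions\<close>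

lemma integral_pair_bool:
  fixes f :: "'a \<times> bool \<Rightarrow> real"
  assumes [measurable]: "f \<in> borel_measurable (\<mu> \<Otimes>\<^sub>M count_space UNIV)" and f0: "\<And>z. 0 \<le> f z"
  shows "(\<integral>z. f z \<partial>(\<mu> \<Otimes>\<^sub>M count_space UNIV)) = (\<integral>x. f (x, True) + f (x, False) \<partial>\<mu>)"
  using f0 by (simp add: integral_eq_nn_integral nn_integral_pair_bool)

text \<open>
  The parameters satisfy \<open>a + b = c\<close> and
  \<open>a - b = c h\<close>, so the outcome \<open>1\<close> contributes \<open>c h\<^sup>2 / 2\<close>: the squared difference is of
  order \<open>c\<^sup>2\<close>, but the outcome itself has probability of order \<open>c\<close>. The outcome \<open>0\<close>
  contributes no more than that.
\<close>

lemma triangular_discrimination_margin: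
  fixes h c :: real
  assumes h: "0 \<le> h" "h \<le> 1" and c: "0 < c" "c \<le> 1"
  defines "a \<equiv> c * ((1 + h) / 2)" and "b \<equiv> c * ((1 - h) / 2)"
  shows "(a - b)\<^sup>2 / (2 * (a + b)) + ((1 - a) - (1 - b))\<^sup>2 / (2 * ((1 - a) + (1 - b))) \<le> c * h\<^sup>2"
    and "(b - a)\<^sup>2 / (2 * (b + a)) + ((1 - b) - (1 - a))\<^sup>2 / (2 * ((1 - b) + (1 - a))) \<le> c * h\<^sup>2"
proof -
  have ab: "a - b = c * h" "a + b = c" by (simp_all add: a_def b_def field_simps)
  have "(a - b)\<^sup>2 / (2 * (a + b)) = c * h\<^sup>2 / 2"
    unfolding ab using c by (simp add: power2_eq_square)
  moreover have "((1 - a) - (1 - b))\<^sup>2 / (2 * ((1 - a) + (1 - b))) = (c * h)\<^sup>2 / (2 * (2 - c))"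
  proof -
    have "(1 - a) - (1 - b) = - (c * h)" "(1 - a) + (1 - b) = 2 - c" using ab by linarith+
    then show ?thesis by simp
  qed
  moreover have "(c * h)\<^sup>2 / (2 * (2 - c)) \<le> (c * h\<^sup>2) / 2"
  proof (rule frac_le)
    have "c\<^sup>2 \<le> c" using c by (simp add: power2_eq_square mult_left_le)
    then show "(c * h)\<^sup>2 \<le> c * h\<^sup>2" by (simp add: power_mult_distrib mult_right_mono)
  qed (use c in auto)
  ultimately show main: "(a - b)\<^sup>2 / (2 * (a + b)) + ((1 - a) - (1 - b))\<^sup>2 / (2 * ((1 - a) + (1 - b))) \<le> c * h\<^sup>2"
    by linarith
  then show "(b - a)\<^sup>2 / (2 * (b + a)) + ((1 - b) - (1 - a))\<^sup>2 / (2 * ((1 - b) + (1 - a))) \<le> c * h\<^sup>2"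
    by (simp only: power2_commute[of b a] power2_commute[of "1 - b"] add.commute[of b a] add.commute[of "1 - b"])
qed

text \<open>
  Two margin distributions with the same marginal differ only where their classifiers do, and
  there each observation contributes at most \<open>c h\<^sup>2\<close> to the discrimination.
\<close>

lemma two_point_testing_labelled_law:
  fixes n :: nat and c h :: real
  assumes \<mu>: "prob_space \<mu>" and g[measurable]: "g \<in> \<mu> \<rightarrow>\<^sub>M count_space UNIV" "g' \<in> \<mu> \<rightarrow>\<^sub>M count_space UNIV"
    and h: "0 \<le> h" "h \<le> 1" and c: "0 < c" "c \<le> 1"
    and close: "n * c * h\<^sup>2 * measure \<mu> {x \<in> space \<mu>. g x \<noteq> g' x} \<le> 1 / 32"
    and A: "A \<in> sets (\<Pi>\<^sub>M i\<in>{..<n}. \<mu> \<Otimes>\<^sub>M count_space (UNIV :: bool set))"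
  shows "measure (\<Pi>\<^sub>M i\<in>{..<n}. labelled_law \<mu> (\<lambda>x. c * margin_regression h g x)) A +
    measure (\<Pi>\<^sub>M i\<in>{..<n}. labelled_law \<mu> (\<lambda>x. c * margin_regression h g' x))
      (space (\<Pi>\<^sub>M i\<in>{..<n}. \<mu> \<Otimes>\<^sub>M count_space (UNIV :: bool set)) - A) \<ge> 1/2"
proof -
  interpret prob_space \<mu> by fact
  define f where "f k z = (if snd z then c * margin_regression h k (fst z)
      else 1 - c * margin_regression h k (fst z))" for k and z :: "'a \<times> bool"
  have law: "labelled_law \<mu> (\<lambda>x. c * margin_regression h k x) = density (\<mu> \<Otimes>\<^sub>M count_space UNIV) (f k)" for k
    unfolding labelled_law_def f_def by (simp add: case_prod_beta')
  have cm: "0 \<le> c * margin_regression h k x \<and> c * margin_regression h k x \<le> 1" for k and x :: 'a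
    using margin_regression_bounds[OF h, of k x] c by (auto intro: mult_le_one)
  have f0: "0 \<le> f k z" for k z using cm[of k "fst z"] by (simp add: f_def)
  have [measurable]: "f g \<in> borel_measurable (\<mu> \<Otimes>\<^sub>M count_space UNIV)"
    "f g' \<in> borel_measurable (\<mu> \<Otimes>\<^sub>M count_space UNIV)" unfolding f_def by measurable
  let ?D = "\<lambda>z. (f g z - f g' z)\<^sup>2 / (2 * (f g z + f g' z))"
  have D0: "0 \<le> ?D z" for z using f0 by simp
  have "(\<integral>z. ?D z \<partial>(\<mu> \<Otimes>\<^sub>M count_space UNIV)) = (\<integral>x. ?D (x, True) + ?D (x, False) \<partial>\<mu>)"
    by (rule integral_pair_bool) (use f0 in auto)
  also have "\<dots> \<le> (\<integral>x. c * h\<^sup>2 * indicator {x \<in> space \<mu>. g x \<noteq> g' x} x \<partial>\<mu>)"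
  proof (rule integral_mono')
    fix x assume "x \<in> space \<mu>"
    then show "?D (x, True) + ?D (x, False) \<le> c * h\<^sup>2 * indicator {x \<in> space \<mu>. g x \<noteq> g' x} x"
      using triangular_discrimination_margin[OF h c]
      by (cases "g x"; cases "g' x"; simp add: f_def margin_regression_def)
  qed (use c in \<open>auto simp: less_top[symmetric]\<close>)
  also have "\<dots> = c * h\<^sup>2 * measure \<mu> {x \<in> space \<mu>. g x \<noteq> g' x}" by simp
  finally have "real n * (\<integral>z. ?D z \<partial>(\<mu> \<Otimes>\<^sub>M count_space UNIV)) \<le>
      real n * (c * h\<^sup>2 * measure \<mu> {x \<in> space \<mu>. g x \<noteq> g' x})"
    by (rule mult_left_mono) simp
  then have v: "real n * (\<integral>z. ?D z \<partial>(\<mu> \<Otimes>\<^sub>M count_space UNIV)) \<le> 1 / 32"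
    using close by (simp add: algebra_simps)
  have prob: "prob_space (density (\<mu> \<Otimes>\<^sub>M count_space UNIV) (f k))"
    if "k \<in> \<mu> \<rightarrow>\<^sub>M count_space UNIV" for k
    unfolding law[symmetric] by (rule prob_space_labelled_law) (use \<mu> that cm in auto)
  show ?thesis
    unfolding law by (rule two_point_testing) (use f0 v A prob g in auto)
qed

section \<open>Averaging over the bits of a shattered set\<close>

text \<open>
  Here \<open>a j B\<close> stands for the probability of missing bit \<open>j\<close> when \<open>B\<close> is the truth. Grouping the
  sets into pairs that differ in the element \<open>j\<close> shows that each bit is missed with probability
  at least \<open>1/4\<close> on average over \<open>B\<close>; some \<open>B\<close> does at least as badly as the average.
\<close>

lemma assouad_average:
  fixes a :: "nat \<Rightarrow> nat set \<Rightarrow> real"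
  assumes pair: "\<And>j B. j < m \<Longrightarrow> B \<subseteq> {..<m} \<Longrightarrow> j \<notin> B \<Longrightarrow> a j B + a j (insert j B) \<ge> 1/2"
  obtains B where "B \<subseteq> {..<m}" "(\<Sum>j<m. a j B) \<ge> m / 4"
proof -
  let ?S = "Pow {..<m}"
  have one: "(\<Sum>B\<in>?S. a j B) \<ge> 2 ^ m / 4" if j: "j < m" for j
  proof -
    let ?R = "Pow ({..<m} - {j})"
    have S: "?S = ?R \<union> insert j ` ?R"
      using j Pow_insert[of j "{..<m} - {j}"] by (simp add: insert_absorb)
    have inj: "inj_on (insert j) ?R" by (auto simp: inj_on_def)
    have cardR: "card ?R = 2 ^ (m - 1)" using j by (simp add: card_Pow)
    have "(2::real) ^ m = 2 * 2 ^ (m - 1)" using j by (cases m) auto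
    then have "(2::real) ^ m / 4 = real (card ?R) * (1/2)" unfolding cardR by simp
    also have "\<dots> \<le> (\<Sum>B\<in>?R. a j B + a j (insert j B))"
    proof (rule sum_bounded_below)
      fix B assume "B \<in> ?R"
      then show "1/2 \<le> a j B + a j (insert j B)" by (intro pair j) auto
    qed
    also have "\<dots> = (\<Sum>B\<in>?R. a j B) + (\<Sum>B\<in>insert j ` ?R. a j B)"
      by (simp add: sum.distrib sum.reindex[OF inj])
    also have "\<dots> = (\<Sum>B\<in>?S. a j B)"
      unfolding S by (rule sum.union_disjoint[symmetric]) auto
    finally show ?thesis .
  qed
  have "\<exists>B\<in>?S. (\<Sum>j<m. a j B) \<ge> m / 4"
  proof (rule ccontr)
    assume "\<not> ?thesis"
    then have "(\<Sum>B\<in>?S. \<Sum>j<m. a j B) < (\<Sum>B\<in>?S. real m / 4)"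
      by (intro sum_strict_mono) (auto simp: not_le)
    also have "\<dots> = (\<Sum>j<m. 2 ^ m / 4)" by (simp add: card_Pow)
    also have "\<dots> \<le> (\<Sum>j<m. \<Sum>B\<in>?S. a j B)" by (rule sum_mono) (use one in auto)
    also have "\<dots> = (\<Sum>B\<in>?S. \<Sum>j<m. a j B)" by (rule sum.swap)
    finally show False by simp
  qed
  then show ?thesis using that by auto
qed

text \<open>
  There are only \<open>2\<close> to the power \<open>length xs\<close> boolean patterns, so attaining that many means
  attaining every one.
\<close>

lemma shatters_realizes:
  assumes "shatters G xs"
  obtains g where "g \<in> G" "\<And>j. j < length xs \<Longrightarrow> g (xs ! j) \<longleftrightarrow> j \<in> B"
proof -
  let ?L = "{l :: bool list. length l = length xs}"
  have L: "finite ?L" "card ?L = 2 ^ length xs"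
    using finite_lists_length_eq[of "UNIV :: bool set" "length xs"]
      card_lists_length_eq[of "UNIV :: bool set" "length xs"] by auto
  have "(\<lambda>g. map g xs) ` G = ?L"
    by (rule card_subset_eq) (use L assms in \<open>auto simp: shatters_def\<close>)
  moreover have "map (\<lambda>j. j \<in> B) [0..<length xs] \<in> ?L" by simp
  ultimately have "map (\<lambda>j. j \<in> B) [0..<length xs] \<in> (\<lambda>g. map g xs) ` G" by simp
  then obtain g where g: "g \<in> G" "map g xs = map (\<lambda>j. j \<in> B) [0..<length xs]"
    by (elim imageE) metis
  have "g (xs ! j) \<longleftrightarrow> j \<in> B" if "j < length xs" for j
    using that arg_cong[OF g(2), of "\<lambda>l. l ! j"] by simp
  then show ?thesis using g that by blast
qed

section \<open>The minimax lower bound\<close>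

lemma exists_pmf_uniform_except_last:
  assumes m: "0 < m" and p: "0 \<le> p" "real m * p \<le> 1"
  obtains W :: "nat pmf" where "set_pmf W \<subseteq> {..m}" "\<And>j. j < m \<Longrightarrow> pmf W j = p"
proof -
  define W where "W = bernoulli_pmf (m * p) \<bind> (\<lambda>b. if b then pmf_of_set {..<m} else return_pmf m)"
  have "set_pmf W \<subseteq> {..m}"
    using m by (auto simp: W_def set_bind_pmf lessThan_empty_iff split: if_splits)
  moreover have "pmf W j = p" if "j < m" for j
    using m p that by (auto simp: W_def pmf_bind lessThan_empty_iff)
  ultimately show ?thesis using that by blast
qed

text \<open>
  The parameter \<open>H\<close> is the margin of the hard distributions. The last hypothesis says that \<open>m\<close>
  points of mass \<open>1 / (32 n c H\<^sup>2)\<close> fit into a probability distribution.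
\<close>

lemma minimax_risk_lower_bound:
  fixes n :: nat and h H c :: real
  assumes meas: "\<forall>g\<in>G. g \<in> Rd d \<rightarrow>\<^sub>M count_space UNIV"
    and xs: "set xs \<subseteq> space (Rd d)" "length xs = Suc m" "shatters G xs" and m: "0 < m"
    and h: "0 < h" "h \<le> H" "H \<le> 1" and c: "0 < c" "c \<le> 1"
    and e: "\<forall>x\<in>space (Rd d). e x = c"
    and n: "0 < n" and large: "real m \<le> 32 * n * c * H\<^sup>2"
  shows "minimax_risk d n e G h \<ge> ereal (m / (128 * (H * n * c)))"
  unfolding minimax_risk_def
proof (rule INF_greatest)
  fix \<phi> assume \<phi>: "\<phi> \<in> estimators d n G"
  have H: "0 < H" using h by simp
  \<comment> \<open>The largest mass for which flipping one bit does not exceed the threshold \<open>1/32\<close> of the two-point test.\<close>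
  define p where "p = 1 / (32 * n * c * H\<^sup>2)"
  have p: "0 \<le> p" "real m * p \<le> 1" using large n c H by (auto simp: p_def divide_simps)
  obtain W where W: "set_pmf W \<subseteq> {..m}" and Wp: "\<And>j. j < m \<Longrightarrow> pmf W j = p"
    using exists_pmf_uniform_except_last[OF m p] by metis
  have "\<exists>g. g \<in> G \<and> (\<forall>j\<le>m. g (xs ! j) \<longleftrightarrow> j \<in> B)" for B
    using shatters_realizes[OF xs(3), of B] xs(2) by (metis less_Suc_eq_le)
  then obtain g where gG: "\<And>B. g B \<in> G" and g: "\<And>B j. j \<le> m \<Longrightarrow> g B (xs ! j) \<longleftrightarrow> j \<in> B" by metis
  \<comment> \<open>Indices above \<open>m\<close> have probability zero; sending them to \<open>xs ! 0\<close> keeps the map inside the space.\<close>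
  define \<mu> where "\<mu> = distr (measure_pmf W) (Rd d) (\<lambda>j. if j \<le> m then xs ! j else xs ! 0)"
  have xj: "j \<le> m \<Longrightarrow> xs ! j \<in> space (Rd d)" for j
    using xs by (simp add: subset_iff less_Suc_eq_le)
  have node_m: "(\<lambda>j. if j \<le> m then xs ! j else xs ! 0) \<in> measure_pmf W \<rightarrow>\<^sub>M Rd d"
    using xj by (auto simp: measurable_def)
  have \<mu>: "prob_space \<mu>" "sets \<mu> = sets (Rd d)"
    unfolding \<mu>_def using node_m by (auto intro: measure_pmf.prob_space_distr)
  have sp: "space \<mu> = space (Rd d)" by (simp add: \<mu>_def)
  have measure_\<mu>: "measure \<mu> {x \<in> space \<mu>. k x} = (\<Sum>j\<le>m. pmf W j * of_bool (k (xs ! j)))"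
    if "k \<in> Rd d \<rightarrow>\<^sub>M count_space UNIV" for k
  proof -
    have [measurable]: "Measurable.pred (Rd d) k" by fact
    have K: "{x \<in> space (Rd d). k x} \<in> sets (Rd d)" by measurable
    have "measure \<mu> {x \<in> space \<mu>. k x} =
        measure (measure_pmf W) {j. k (if j \<le> m then xs ! j else xs ! 0) \<and> (if j \<le> m then xs ! j else xs ! 0) \<in> space (Rd d)}"
      unfolding sp unfolding \<mu>_def by (subst measure_distr[OF node_m K]) (simp add: vimage_def conj_commute)
    also have "\<dots> = measure (measure_pmf W) {j \<in> {..m}. k (xs ! j)}"
      by (rule measure_pmf.finite_measure_eq_AE) (use W xj in \<open>auto simp: AE_measure_pmf_iff\<close>)
    also have "\<dots> = (\<Sum>j \<in> {j \<in> {..m}. k (xs ! j)}. pmf W j)"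
      by (rule measure_measure_pmf_finite) simp
    also have "\<dots> = (\<Sum>j\<le>m. pmf W j * of_bool (k (xs ! j)))"
      by (simp add: sum_mult_of_bool_eq Int_def)
    finally show ?thesis .
  qed
  define P where "P B = labelled_law \<mu> (margin_regression H (g B))" for B
  have P: "P B \<in> margin_class d G h" for B
    unfolding P_def by (rule labelled_law_in_margin_class) (use \<mu> meas gG h in auto)
  define S where "S B = sample_law d n e (P B)" for B
  have gm: "g B \<in> \<mu> \<rightarrow>\<^sub>M count_space UNIV" for B
    unfolding measurable_cong_sets[OF \<mu>(2) refl] using meas gG by blast
  have obs: "observed_law d e (P B) = labelled_law \<mu> (\<lambda>x. c * margin_regression H (g B) x)" for B
    unfolding P_def
  proof (rule observed_law_labelled_law)
    show "margin_regression H (g B) \<in> borel_measurable \<mu>"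
      by (rule margin_regression_measurable[OF gm])
    show "0 \<le> margin_regression H (g B) x \<and> margin_regression H (g B) x \<le> 1" for x
      using H h(3) by (simp add: margin_regression_bounds)
    show "e x = c" if "x \<in> space (Rd d)" for x using e that by simp
  qed (use \<mu>(2) c in simp_all)
  have S: "S B = (\<Pi>\<^sub>M i\<in>{..<n}. labelled_law \<mu> (\<lambda>x. c * margin_regression H (g B) x))" for B
    by (simp add: S_def sample_law_def obs)
  have sets_base: "sets (\<Pi>\<^sub>M i\<in>{..<n}. \<mu> \<Otimes>\<^sub>M count_space UNIV) = sets (sample_space d n)"
    unfolding sample_space_def labelled_space_def using \<mu>
    by (intro sets_PiM_cong sets_pair_measure_cong) auto
  have sets_S: "sets (S B) = sets (sample_space d n)" for B
    unfolding S sets_base[symmetric] by (intro sets_PiM_cong) (auto simp: sets_labelled_law)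
  note space_S = sets_eq_imp_space_eq[OF sets_S]
  have prob_S: "prob_space (S B)" for B
    unfolding S
  proof (intro prob_space_PiM prob_space_labelled_law)
    show "0 \<le> c * margin_regression H (g B) x \<and> c * margin_regression H (g B) x \<le> 1" for x
      using margin_regression_bounds[of H "g B" x] H h c by (auto intro: mult_le_one)
  qed (use \<mu> gm in auto)
  have \<phi>m: "(\<lambda>s. \<phi> s (xs ! j)) \<in> sample_space d n \<rightarrow>\<^sub>M count_space UNIV" if "j \<le> m" for j
  proof -
    have "(\<lambda>(s, x). \<phi> s x) \<in> sample_space d n \<Otimes>\<^sub>M Rd d \<rightarrow>\<^sub>M count_space UNIV"
      using \<phi> by (simp add: estimators_def)
    from measurable_Pair_compose_split[OF this measurable_ident_sets[OF refl] measurable_const[OF xj[OF that]]]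
    show ?thesis by simp
  qed
  define a where "a j B = measure (S B) {s \<in> space (sample_space d n). \<phi> s (xs ! j) \<noteq> (j \<in> B)}" for j B
  have risk: "(\<integral>s. excess_risk d (P B) (\<phi> s) \<partial>S B) = H * (\<Sum>j\<le>m. pmf W j * a j B)" for B
  proof -
    interpret prob_space "S B" by (rule prob_S)
    have \<phi>S: "Measurable.pred (S B) (\<lambda>s. \<phi> s (xs ! j))" if "j \<le> m" for j
      unfolding measurable_cong_sets[OF sets_S refl] by (rule \<phi>m[OF that])
    have ev: "{s \<in> space (sample_space d n). \<phi> s (xs ! j) \<noteq> (j \<in> B)} \<in> events" if "j \<le> m" for j
      using \<phi>S[OF that] unfolding space_S[symmetric, of B] by measurable
    have "(\<integral>s. excess_risk d (P B) (\<phi> s) \<partial>S B) =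
        (\<integral>s. H * (\<Sum>j\<le>m. pmf W j * indicator {s \<in> space (sample_space d n). \<phi> s (xs ! j) \<noteq> (j \<in> B)} s) \<partial>S B)"
    proof (rule Bochner_Integration.integral_cong)
      fix s assume "s \<in> space (S B)"
      then have s: "s \<in> space (sample_space d n)" by (simp add: space_S)
      then have \<phi>s: "\<phi> s \<in> Rd d \<rightarrow>\<^sub>M count_space UNIV" and gB: "g B \<in> Rd d \<rightarrow>\<^sub>M count_space UNIV"
        using \<phi> meas gG by (auto simp: estimators_def)
      have "excess_risk d (P B) (\<phi> s) = H * measure \<mu> {x \<in> space \<mu>. \<phi> s x \<noteq> g B x}"
        unfolding P_def by (rule excess_risk_margin_regression) (use \<mu> \<phi>s gB h in auto)
      also have "\<dots> = H * (\<Sum>j\<le>m. pmf W j * of_bool (\<phi> s (xs ! j) \<noteq> g B (xs ! j)))"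
        by (subst measure_\<mu>) (use \<phi>s gB in measurable)
      also have "\<dots> = H * (\<Sum>j\<le>m. pmf W j * indicator {s \<in> space (sample_space d n). \<phi> s (xs ! j) \<noteq> (j \<in> B)} s)"
        by (intro arg_cong[where f="\<lambda>t. H * t"] sum.cong) (use s g in \<open>auto simp: indicator_def\<close>)
      finally show "excess_risk d (P B) (\<phi> s) =
        H * (\<Sum>j\<le>m. pmf W j * indicator {s \<in> space (sample_space d n). \<phi> s (xs ! j) \<noteq> (j \<in> B)} s)" .
    qed simp
    also have "\<dots> = H * (\<Sum>j\<le>m. pmf W j * a j B)"
    proof -
      have "integrable (S B) (\<lambda>s. indicator {s \<in> space (sample_space d n). \<phi> s (xs ! j) \<noteq> (j \<in> B)} s :: real)"
        if "j \<le> m" for j using ev[OF that] by (simp add: less_top[symmetric])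
      moreover have "(\<integral>s. indicator {s \<in> space (sample_space d n). \<phi> s (xs ! j) \<noteq> (j \<in> B)} s \<partial>S B) = a j B"
        if "j \<le> m" for j
        using ev[OF that] sets.sets_into_space[OF ev[OF that]] by (simp add: a_def Int_absorb2)
      ultimately show ?thesis
        by (subst integral_mult_right_zero, subst Bochner_Integration.integral_sum) auto
    qed
    finally show ?thesis .
  qed
  \<comment> \<open>Whether the estimator answers \<open>1\<close> at \<open>xs ! j\<close> is a test between \<open>B\<close> and \<open>insert j B\<close>, and these two laws differ only at that point.\<close>
  have pair: "a j B + a j (insert j B) \<ge> 1/2" if j: "j < m" and B: "j \<notin> B" for j B
  proof -
    let ?A = "{s \<in> space (sample_space d n). \<phi> s (xs ! j)}"
    have A: "?A \<in> sets (sample_space d n)" using \<phi>m[of j] j by simp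
    have "measure \<mu> {x \<in> space \<mu>. g B x \<noteq> g (insert j B) x} =
        (\<Sum>i\<le>m. pmf W i * of_bool (g B (xs ! i) \<noteq> g (insert j B) (xs ! i)))"
      by (rule measure_\<mu>) (use meas gG in \<open>auto intro!: pred_intros_logic\<close>)
    also have "\<dots> = (\<Sum>i\<le>m. if i = j then pmf W i else 0)"
      by (rule sum.cong) (use g B in auto)
    also have "\<dots> = p" using j by (simp add: Wp)
    finally have d: "measure \<mu> {x \<in> space \<mu>. g B x \<noteq> g (insert j B) x} = p" .
    have "n * c * H\<^sup>2 * p = 1 / 32" using n c H by (simp add: p_def)
    then have "1/2 \<le> measure (S B) ?A + measure (S (insert j B)) (space (sample_space d n) - ?A)"
      unfolding S sets_eq_imp_space_eq[OF sets_base, symmetric]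
      by (intro two_point_testing_labelled_law)
        (use \<mu> gm h H c d A in \<open>auto simp: sets_base sets_eq_imp_space_eq[OF sets_base]\<close>)
    also have "?A = {s \<in> space (sample_space d n). \<phi> s (xs ! j) \<noteq> (j \<in> B)}" using B by auto
    also have "space (sample_space d n) - {s \<in> space (sample_space d n). \<phi> s (xs ! j) \<noteq> (j \<in> B)} =
        {s \<in> space (sample_space d n). \<phi> s (xs ! j) \<noteq> (j \<in> insert j B)}" using B by auto
    finally show ?thesis by (simp add: a_def)
  qed
  \<comment> \<open>Only the first \<open>m\<close> bits are counted; the heavy point \<open>xs ! m\<close> has the same label for all sets \<open>B \<subseteq> {..<m}\<close>.\<close>
  obtain B where B: "(\<Sum>j<m. a j B) \<ge> m / 4"
    using assouad_average[of m a] pair by metis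
  have "m / (128 * (H * n * c)) = H * (p * (m / 4))"
    using H n c by (simp add: p_def power2_eq_square)
  also have "\<dots> \<le> H * (p * (\<Sum>j<m. a j B))"
    using B H p by (intro mult_left_mono) auto
  also have "p * (\<Sum>j<m. a j B) = (\<Sum>j<m. pmf W j * a j B)" by (simp add: sum_distrib_left Wp)
  also have "H * \<dots> \<le> H * (\<Sum>j\<le>m. pmf W j * a j B)"
    using H by (intro mult_left_mono sum_mono2) (auto simp: a_def)
  also have "\<dots> = (\<integral>s. excess_risk d (P B) (\<phi> s) \<partial>sample_law d n e (P B))"
    using risk[of B] by (simp add: S_def)
  finally have "ereal (m / (128 * (H * n * c))) \<le> ereal (\<integral>s. excess_risk d (P B) (\<phi> s) \<partial>sample_law d n e (P B))"
    by simp
  then show "ereal (m / (128 * (H * n * c))) \<le>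
      (SUP P\<in>margin_class d G h. ereal (\<integral>s. excess_risk d P (\<phi> s) \<partial>sample_law d n e P))"
    by (rule SUP_upper2[OF P])
qed

theorem theorem2:
  "\<exists>\<kappa>\<^sub>2::real. \<kappa>\<^sub>2 > 0 \<and>
     (\<forall>(d::nat) (G::classifier set) (V::nat) (n::nat) (h::real) (e\<^sub>m::real)
        (e::(nat \<Rightarrow> real) \<Rightarrow> real) (h'::real).
        (\<forall>g\<in>G. g \<in> Rd d \<rightarrow>\<^sub>M count_space UNIV) \<longrightarrow>
        has_vc_dimension d G V \<longrightarrow>
        n \<ge> 1 \<longrightarrow>
        0 < h \<longrightarrow> h \<le> 1 \<longrightarrow>
        0 < e\<^sub>m \<longrightarrow> e\<^sub>m \<le> 1 \<longrightarrow>
        V \<ge> 2 \<longrightarrow>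
        real n * e\<^sub>m \<ge> real V \<longrightarrow>
        (\<forall>x\<in>space (Rd d). e x = e\<^sub>m) \<longrightarrow>
        h' = sqrt (real V / (real n * e\<^sub>m)) \<longrightarrow>
        (h \<ge> h' \<longrightarrow>
           minimax_risk d n e G h \<ge> ereal (\<kappa>\<^sub>2 * ((real V - 1) / (h * real n * e\<^sub>m)))) \<and>
        (h \<le> h' \<longrightarrow>
           minimax_risk d n e G h \<ge> ereal (\<kappa>\<^sub>2 * sqrt ((real V - 1) / (real n * e\<^sub>m)))))"
proof (intro exI[of _ "1/256"] conjI allI impI)
  show "(0::real) < 1/256" by simp
  fix d V n :: nat and G :: "classifier set" and h e\<^sub>m h' :: real and e :: "(nat \<Rightarrow> real) \<Rightarrow> real"
  assume meas: "\<forall>g\<in>G. g \<in> Rd d \<rightarrow>\<^sub>M count_space UNIV" and vc: "has_vc_dimension d G V"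
    and n: "n \<ge> 1" and h: "0 < h" "h \<le> 1" and em: "0 < e\<^sub>m" "e\<^sub>m \<le> 1" and V: "V \<ge> 2"
    and nV: "real n * e\<^sub>m \<ge> real V" and e: "\<forall>x\<in>space (Rd d). e x = e\<^sub>m"
    and h': "h' = sqrt (real V / (real n * e\<^sub>m))"
  obtain xs where xs: "set xs \<subseteq> space (Rd d)" "length xs = V" "shatters G xs"
    using vc by (auto simp: has_vc_dimension_def)
  have V1: "real (V - 1) = real V - 1" and SV: "length xs = Suc (V - 1)" and V0: "0 < V - 1"
    using V xs(2) by auto
  have N: "0 < real n * e\<^sub>m" using n em by simp
  have h'2: "real n * e\<^sub>m * h'\<^sup>2 = V" using n em by (simp add: h')
  have h'0: "0 < h'" using N V by (simp add: h')
  have h'1: "h' \<le> 1" using N nV by (simp add: h')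
  have bound: "minimax_risk d n e G h \<ge> ereal ((real V - 1) / (128 * (H * n * e\<^sub>m)))"
    if H: "h \<le> H" "h' \<le> H" "H \<le> 1" for H
  proof -
    have "real n * e\<^sub>m * h'\<^sup>2 \<le> real n * e\<^sub>m * H\<^sup>2"
      using N H h'0 by (intro mult_left_mono power_mono) auto
    then have "real (V - 1) \<le> 32 * n * e\<^sub>m * H\<^sup>2" using h'2 V1 by linarith
    from minimax_risk_lower_bound[OF meas xs(1) SV xs(3) V0 h(1) H(1,3) em e _ this] n
    show ?thesis unfolding V1 by simp
  qed
  show "minimax_risk d n e G h \<ge> ereal (1/256 * ((real V - 1) / (h * real n * e\<^sub>m)))" if "h \<ge> h'"
  proof -
    have "1/256 * ((real V - 1) / (h * real n * e\<^sub>m)) \<le> (real V - 1) / (128 * (h * n * e\<^sub>m))"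
      using V n h em by (simp add: divide_simps)
    then have "ereal (1/256 * ((real V - 1) / (h * real n * e\<^sub>m))) \<le>
        ereal ((real V - 1) / (128 * (h * n * e\<^sub>m)))" by (simp only: ereal_less_eq)
    also have "\<dots> \<le> minimax_risk d n e G h" by (rule bound) (use that h in auto)
    finally show ?thesis .
  qed
  show "minimax_risk d n e G h \<ge> ereal (1/256 * sqrt ((real V - 1) / (real n * e\<^sub>m)))" if "h \<le> h'"
  proof -
    \<comment> \<open>Using \<open>V \<le> 4 (V - 1)\<close>, which holds as \<open>V \<ge> 2\<close>, to pass from \<open>(V - 1) / sqrt V\<close> to \<open>sqrt (V - 1)\<close>.\<close>
    let ?N = "real n * e\<^sub>m" and ?v = "real V - 1"
    have "1/256 * sqrt (?v / ?N) \<le> ?v / (128 * (h' * n * e\<^sub>m))"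
    proof -
      have "h' * sqrt (?v / ?N) = sqrt ((V * ?v) / ?N\<^sup>2)"
        unfolding h' real_sqrt_mult[symmetric] by (simp add: power2_eq_square)
      also have "\<dots> = sqrt (V * ?v) / ?N"
        using N by (simp only: real_sqrt_divide real_sqrt_abs abs_of_pos)
      finally have "h' * sqrt (?v / ?N) * ?N = sqrt (V * ?v)" using N by (metis nonzero_eq_divide_eq less_irrefl)
      also have "\<dots> \<le> sqrt ((2 * ?v)\<^sup>2)"
      proof (rule real_sqrt_le_mono)
        have "real V * ?v \<le> (4 * ?v) * ?v" using V by (intro mult_right_mono) auto
        also have "(4 * t) * t = (2 * t)\<^sup>2" for t :: real by (simp add: power2_eq_square)
        finally show "real V * ?v \<le> (2 * ?v)\<^sup>2" .
      qed
      also have "\<dots> = 2 * ?v" using V by (simp add: real_sqrt_abs)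
      finally have le: "h' * sqrt (?v / ?N) * ?N \<le> 2 * ?v" .
      have half: "b / 2 \<le> t" if "b \<le> 2 * t" for b t :: real using that by simp
      have "1/256 * sqrt (?v / ?N) * (128 * (h' * n * e\<^sub>m)) = h' * sqrt (?v / ?N) * ?N / 2"
        by simp
      also have "\<dots> \<le> ?v" using le by (rule half)
      finally have "1/256 * sqrt (?v / ?N) * (128 * (h' * n * e\<^sub>m)) \<le> ?v" .
      moreover have "0 < 128 * (h' * n * e\<^sub>m)" using N h'0 by (simp add: mult.assoc)
      ultimately show ?thesis by (simp only: pos_le_divide_eq)
    qed
    then have "ereal (1/256 * sqrt (?v / ?N)) \<le> ereal (?v / (128 * (h' * n * e\<^sub>m)))"
      by (simp only: ereal_less_eq)
    also have "\<dots> \<le> minimax_risk d n e G h" by (rule bound) (use that h'1 in auto)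
    finally show ?thesis .
  qed
qed

end
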